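(* Let $X=(X_t)_{t\ge0}$ be an integrable real-valued càdlàg process satisfying, for every $T>0$, a co-monotony principle for the sup-norm on the interval $[0,T]$, and let $\mu$ be a Borel measure on $(\mathbb{R}_+,\mathcal{B}or(\mathbb{R}_+))$. Assume that $\sup_{s\in[0,t]}\mathbb{E}\,|X_s|<+\infty$ for every $t>0$ and that $t\mapsto\mathbb{E}\,X_t$ is càdlàg. Then the process $$\Big(\int_{[0,t]}(X_s-\mathbb{E}\,X_s)\,\mu(ds)\Big)_{t\ge0}$$ is a peacock.
   Context: $\mathcal{B}or(\mathbb{R}_+)$ is the Borel $\sigma$-field of $\mathbb{R}_+$. Càdlàg means right continuous with left limits. An integrable real-valued process $(Y_\lambda)_{\lambda\ge0}$ is a peacock if, for every convex function $\varphi:\mathbb{R}\to\mathbb{R}$, the $(-\infty,+\infty]$-valued function $\lambda\mapsto\mathbb{E}\,\varphi(Y_\lambda)$ is non-decreasing. $\mathbb{D}([0,T],\mathbb{R})$ is the space of càdlàg functions on $[0,T]$, with the $\sigma$-field generated by the evaluations, the sup-norm, and the pointwise order ($\alpha\le\beta$ if $\alpha(t)\le\beta(t)$ for all $t\in[0,T]$). Two measurable functionals are co-monotone if they are both non-decreasing or both non-increasing for this order. $X$ satisfies a co-monotony principle for the sup-norm on $[0,T]$ if $\mathbb{E}\,F(X)G(X)\ge\mathbb{E}\,F(X)\,\mathbb{E}\,G(X)$ (with $X$ restricted to $[0,T]$) for every pair of bounded, co-monotone, measurable functionals $F,G:\mathbb{D}([0,T],\mathbb{R})\to\mathbb{R}$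 that are $\mathbb{P}_X$-a.s. continuous for the sup-norm (continuous at every point of a set of probability $1$ under the distribution of $X$). *)

theory Defs
  imports "HOL-Probability.Probability"
begin

text \<open>Relative to \<open>S\<close>: at a left (right) end point of \<open>S\<close> the condition on the left limit
  (on right continuity) is void, because the filter involved is trivial.\<close>

definition cadlag_on :: "real set \<Rightarrow> (real \<Rightarrow> real) \<Rightarrow> bool" where
  "cadlag_on S f \<longleftrightarrow>
     (\<forall>t\<in>S. (f \<longlongrightarrow> f t) (at t within S \<inter> {t<..}) \<and>
            (\<exists>l. (f \<longlongrightarrow> l) (at t within S \<inter> {..<t})))"

text \<open>The space \<open>D([0,T],\<real>)\<close>. Functions on \<open>[0,T]\<close> are represented by functions on the whole real
  line that take the value \<open>undefined\<close> outside \<open>[0,T]\<close>, as in \<^const>\<open>PiM\<close>.\<close>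

definition cadlag_paths :: "real \<Rightarrow> (real \<Rightarrow> real) set" where
  "cadlag_paths T = {x \<in> extensional {0..T}. cadlag_on {0..T} x}"

text \<open>The trace on \<open>D([0,T],\<real>)\<close> of the product \<open>\<sigma>\<close>-field is the \<open>\<sigma>\<close>-field generated by the
  evaluations \<open>x \<mapsto> x t\<close>, \<open>t \<in> [0,T]\<close>. Only the measurable structure is used.\<close>

definition cadlag_space :: "real \<Rightarrow> (real \<Rightarrow> real) measure" where
  "cadlag_space T = restrict_space (PiM {0..T} (\<lambda>_. borel)) (cadlag_paths T)"

text \<open>A supremum of reals, meaningful here because cadlag functions on \<open>[0,T]\<close> are bounded.\<close>

definition sup_norm :: "real \<Rightarrow> (real \<Rightarrow> real) \<Rightarrow> real" where
  "sup_norm T x = (SUP t\<in>{0..T}. \<bar>x t\<bar>)"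

definition sup_norm_continuous_at ::
    "real \<Rightarrow> ((real \<Rightarrow> real) \<Rightarrow> real) \<Rightarrow> (real \<Rightarrow> real) \<Rightarrow> bool" where
  "sup_norm_continuous_at T F x \<longleftrightarrow>
     (\<forall>\<epsilon>>0. \<exists>\<delta>>0. \<forall>y\<in>cadlag_paths T.
        sup_norm T (\<lambda>t. y t - x t) < \<delta> \<longrightarrow> \<bar>F y - F x\<bar> < \<epsilon>)"

definition path_le :: "real \<Rightarrow> (real \<Rightarrow> real) \<Rightarrow> (real \<Rightarrow> real) \<Rightarrow> bool" where
  "path_le T \<alpha> \<beta> \<longleftrightarrow> (\<forall>t\<in>{0..T}. \<alpha> t \<le> \<beta> t)"

definition co_monotone ::
    "real \<Rightarrow> ((real \<Rightarrow> real) \<Rightarrow> real) \<Rightarrow> ((real \<Rightarrow> real) \<Rightarrow> real) \<Rightarrow> bool" where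
  "co_monotone T F G \<longleftrightarrow>
     (monotone_on (cadlag_paths T) (path_le T) (\<le>) F \<and>
      monotone_on (cadlag_paths T) (path_le T) (\<le>) G) \<or>
     (monotone_on (cadlag_paths T) (path_le T) (\<ge>) F \<and>
      monotone_on (cadlag_paths T) (path_le T) (\<ge>) G)"

definition path_on :: "real \<Rightarrow> (real \<Rightarrow> 'a \<Rightarrow> real) \<Rightarrow> 'a \<Rightarrow> real \<Rightarrow> real" where
  "path_on T X \<omega> = restrict (\<lambda>t. X t \<omega>) {0..T}"

definition path_law :: "'a measure \<Rightarrow> real \<Rightarrow> (real \<Rightarrow> 'a \<Rightarrow> real) \<Rightarrow> (real \<Rightarrow> real) measure" where
  "path_law M T X = distr M (cadlag_space T) (path_on T X)"

definition co_monotony_principle :: "'a measure \<Rightarrow> real \<Rightarrow> (real \<Rightarrow> 'a \<Rightarrow> real) \<Rightarrow> bool" where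
  "co_monotony_principle M T X \<longleftrightarrow>
     (\<forall>F G. F \<in> borel_measurable (cadlag_space T) \<and> G \<in> borel_measurable (cadlag_space T) \<and>
        bounded (F ` cadlag_paths T) \<and> bounded (G ` cadlag_paths T) \<and>
        co_monotone T F G \<and>
        (AE x in path_law M T X. sup_norm_continuous_at T F x) \<and>
        (AE x in path_law M T X. sup_norm_continuous_at T G x) \<longrightarrow>
        (\<integral>\<omega>. F (path_on T X \<omega>) * G (path_on T X \<omega>) \<partial>M) \<ge>
        (\<integral>\<omega>. F (path_on T X \<omega>) \<partial>M) * (\<integral>\<omega>. G (path_on T X \<omega>) \<partial>M))"

text \<open>Expectation with values in the extended reals, as the integral of the positive part minus the
  integral of the negative part (\<^const>\<open>ennreal\<close> sends negative numbers to 0). The case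
  \<open>\<infinity> - \<infinity>\<close> does not occur for a convex function of an integrable variable, since a convex function
  has an affine minorant.\<close>

definition ext_expectation :: "'a measure \<Rightarrow> ('a \<Rightarrow> real) \<Rightarrow> ereal" where
  "ext_expectation M f =
     enn2ereal (\<integral>\<^sup>+\<omega>. ennreal (f \<omega>) \<partial>M) - enn2ereal (\<integral>\<^sup>+\<omega>. ennreal (- f \<omega>) \<partial>M)"

definition peacock :: "'a measure \<Rightarrow> (real \<Rightarrow> 'a \<Rightarrow> real) \<Rightarrow> bool" where
  "peacock M Y \<longleftrightarrow>
     (\<forall>t\<ge>0. integrable M (Y t)) \<and>
     (\<forall>\<phi>. convex_on UNIV \<phi> \<longrightarrow> mono_on {0..} (\<lambda>t. ext_expectation M (\<lambda>\<omega>. \<phi> (Y t \<omega>))))"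

text \<open>Borel measures on \<open>[0,\<infinity>)\<close> are understood to be finite on compact sets, without which the
  integrals over \<open>[0,t]\<close> need not be defined.\<close>

definition borel_measure_nonneg :: "real measure \<Rightarrow> bool" where
  "borel_measure_nonneg \<mu> \<longleftrightarrow>
     sets \<mu> = sets (restrict_space borel {0..}) \<and>
     (\<forall>K. compact K \<and> K \<subseteq> {0..} \<longrightarrow> emeasure \<mu> K < \<infinity>)"

end

theory Submission
  imports Defs "HOL-Real_Asymp.Real_Asymp"
begin

text \<open>Write \<open>Y\<^sub>t = Y\<^sub>s + W\<close> with \<open>W\<close> the centred integral over \<open>(s,t]\<close>. If \<open>p\<close> is a subgradient
  of the convex function \<open>\<phi>\<close>, then \<open>\<phi> (Y\<^sub>t) \<ge> \<phi> (Y\<^sub>s) + p (Y\<^sub>s) W\<close>, so it is enough that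
  \<open>E (p (Y\<^sub>s) W) \<ge> 0 = E (p (Y\<^sub>s)) E W\<close>. Both \<open>Y\<^sub>s\<close> and \<open>W\<close> are non-decreasing and Lipschitz functionals
  of the path for the sup-norm, hence co-monotony applies once \<open>p\<close> and \<open>W\<close> are replaced by bounded
  continuous non-decreasing functions: \<open>W\<close> is truncated, and \<open>p\<close>, taken to be the right derivative of
  \<open>\<phi>\<close> frozen outside \<open>[-n,n]\<close>, is the limit of the continuous functions
  \<open>x \<mapsto> k (\<phi> (x + 1/k) - \<phi> x)\<close>. Freezing \<open>p\<close> means replacing \<open>\<phi>\<close> by its affine extrapolation
  outside \<open>[-n,n]\<close>, and Fatou's lemma removes the truncation.\<close>

section \<open>Convex functions on the line: chords and the right derivative\<close>

lemma convex_on_increment_mono: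
  fixes \<phi> :: "real \<Rightarrow> real"
  assumes \<phi>: "convex_on UNIV \<phi>" and "x \<le> y" "e > 0"
  shows "\<phi> (x + e) - \<phi> x \<le> \<phi> (y + e) - \<phi> y"
proof -
  \<comment> \<open>The inner points \<open>x + e\<close> and \<open>y\<close> are convex
    combinations of the outer points \<open>x\<close> and \<open>y + e\<close> with exchanged
    weights, so adding the two convexity inequalities gives the claim.\<close>
  define l where "l = e / (y - x + e)"
  have pos: "y - x + e > 0" using assms by simp
  have l: "0 \<le> l" "l \<le> 1" using assms by (auto simp: l_def field_simps)
  have le: "l * (y + e - x) = e" using pos by (simp add: l_def field_simps)
  have 1: "\<phi> ((1 - l) * x + l * (y + e)) \<le> (1 - l) * \<phi> x + l * \<phi> (y + e)"
    using convex_onD[OF \<phi> l, of x "y + e"] by simp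
  have 2: "\<phi> ((1 - l) * (y + e) + l * x) \<le> (1 - l) * \<phi> (y + e) + l * \<phi> x"
    using convex_onD[OF \<phi> l, of "y + e" x] by simp
  have "(1 - l) * x + l * (y + e) = x + e" "(1 - l) * (y + e) + l * x = y"
    using le by (auto simp: algebra_simps)
  with 1 2 show ?thesis by (simp add: algebra_simps)
qed

text \<open>The slopes of chords starting at \<open>x\<close> decrease as the chord shortens and
  stay above all slopes of chords ending at \<open>x\<close>, so they converge. The limit inherits
  both comparisons, which are the subgradient inequality on the two sides of \<open>x\<close>. The
  convergence is kept in the conclusion because the quotients are continuous in \<open>x\<close>,
  while \<open>p\<close> may jump.\<close>

lemma convex_on_right_derivative:
  fixes \<phi> :: "real \<Rightarrow> real"
  assumes \<phi>: "convex_on UNIV \<phi>"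
  obtains p where "\<And>x y. \<phi> y \<ge> \<phi> x + p x * (y - x)"
    "\<And>x. (\<lambda>k. real (Suc k) * (\<phi> (x + 1 / real (Suc k)) - \<phi> x)) \<longlonglongrightarrow> p x"
proof -
  define q where "q x k = real (Suc k) * (\<phi> (x + 1 / real (Suc k)) - \<phi> x)" for x k
  have right: "q x k * d \<le> \<phi> (x + d) - \<phi> x" if "1 / real (Suc k) \<le> d" for x k d
  proof -
    \<comment> \<open>The relative position of \<open>x + 1 / real (Suc k)\<close> between
      \<open>x\<close> and \<open>x + d\<close>.\<close>
    define l where "l = 1 / (real (Suc k) * d)"
    have d: "d > 0" using that by (smt (verit) divide_pos_pos of_nat_0_less_iff zero_less_Suc)
    have l: "0 \<le> l" "l \<le> 1" using d that by (auto simp: l_def field_simps)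
    have ld: "l * d = 1 / real (Suc k)" using d by (simp add: l_def)
    have "\<phi> ((1 - l) * x + l * (x + d)) \<le> (1 - l) * \<phi> x + l * \<phi> (x + d)"
      using convex_onD[OF \<phi> l, of x "x + d"] by simp
    moreover have "(1 - l) * x + l * (x + d) = x + 1 / real (Suc k)"
      unfolding ld[symmetric] by (simp add: algebra_simps)
    ultimately have "\<phi> (x + 1 / real (Suc k)) - \<phi> x \<le> l * (\<phi> (x + d) - \<phi> x)"
      by (simp add: algebra_simps)
    then have "(real (Suc k) * d) * (\<phi> (x + 1 / real (Suc k)) - \<phi> x)
        \<le> (real (Suc k) * d) * (l * (\<phi> (x + d) - \<phi> x))"
      using d by (intro mult_left_mono) auto
    also have "\<dots> = (real (Suc k) * d * l) * (\<phi> (x + d) - \<phi> x)"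
      by (simp only: mult.assoc)
    also have "real (Suc k) * d * l = 1" using d by (simp add: l_def)
    finally show ?thesis by (simp add: q_def mult_ac)
  qed
  have left: "\<phi> x - \<phi> (x - d) \<le> q x k * d" if "d > 0" for x k d
  proof -
    define e where "e = 1 / real (Suc k)"
    \<comment> \<open>The weight on \<open>x - d\<close> that makes \<open>x\<close> a mean of
      \<open>x - d\<close> and \<open>x + e\<close>.\<close>
    define l where "l = e / (d + e)"
    have e: "e > 0" by (simp add: e_def)
    have l: "0 \<le> l" "l \<le> 1" using e that by (auto simp: l_def field_simps)
    have lde: "l * (d + e) = e" using that e by (simp add: l_def)
    have "\<phi> ((1 - l) * (x + e) + l * (x - d)) \<le> (1 - l) * \<phi> (x + e) + l * \<phi> (x - d)"
      using convex_onD[OF \<phi> l, of "x + e" "x - d"] by simp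
    moreover have "(1 - l) * (x + e) + l * (x - d) = x" using lde by (simp add: algebra_simps)
    ultimately have "\<phi> x \<le> (1 - l) * \<phi> (x + e) + l * \<phi> (x - d)" by simp
    then have "(d + e) * \<phi> x \<le> (d + e) * ((1 - l) * \<phi> (x + e) + l * \<phi> (x - d))"
      using that e by (intro mult_left_mono) auto
    also have "\<dots> = (d + e - l * (d + e)) * \<phi> (x + e) + (l * (d + e)) * \<phi> (x - d)"
      by (simp add: algebra_simps)
    also have "\<dots> = d * \<phi> (x + e) + e * \<phi> (x - d)" unfolding lde by simp
    finally have "e * (\<phi> x - \<phi> (x - d)) \<le> d * (\<phi> (x + e) - \<phi> x)"
      by (simp add: algebra_simps)
    then have "real (Suc k) * (e * (\<phi> x - \<phi> (x - d))) \<le> real (Suc k) * (d * (\<phi> (x + e) - \<phi> x))"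
      by (intro mult_left_mono) auto
    moreover have "real (Suc k) * (e * (\<phi> x - \<phi> (x - d))) = \<phi> x - \<phi> (x - d)"
      by (simp add: e_def)
    ultimately show ?thesis by (simp add: q_def e_def mult_ac)
  qed
  have conv: "\<exists>L. q x \<longlonglongrightarrow> L" for x
  proof -
    have "decseq (q x)"
    proof (rule decseq_SucI)
      fix k
      \<comment> \<open>The chord of index \<open>Suc k\<close> is compared with the longer one of
        index \<open>k\<close>, by \<open>right\<close> at the distance
        \<open>1 / real (Suc k)\<close>.\<close>
      have "q x (Suc k) * (1 / real (Suc k)) \<le> \<phi> (x + 1 / real (Suc k)) - \<phi> x"
        by (rule right) (simp add: field_simps)
      then have "q x (Suc k) * (1 / real (Suc k)) * real (Suc k) \<le> (\<phi> (x + 1 / real (Suc k)) - \<phi> x) * real (Suc k)"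
        by (intro mult_right_mono) auto
      then show "q x (Suc k) \<le> q x k" by (simp add: q_def mult.commute)
    qed
    moreover have "\<forall>k. \<phi> x - \<phi> (x - 1) \<le> q x k" using left[of 1 x] by simp
    ultimately show ?thesis by (metis decseq_convergent)
  qed
  define p where "p x = (SOME L. q x \<longlonglongrightarrow> L)" for x
  have p: "q x \<longlonglongrightarrow> p x" for x
    unfolding p_def using conv[of x] by (rule someI_ex)
  have "\<phi> y \<ge> \<phi> x + p x * (y - x)" for x y
  proof (cases x y rule: linorder_cases)
    case less
    have "(\<lambda>k. q x k * (y - x)) \<longlonglongrightarrow> p x * (y - x)" by (intro tendsto_intros p)
    \<comment> \<open>\<open>right\<close> only concerns chords that do not pass \<open>y\<close>,
      hence the restriction to large \<open>k\<close>; \<open>left\<close> holds for every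
      \<open>k\<close>.\<close>
    moreover have "eventually (\<lambda>k. 1 / real (Suc k) < y - x) sequentially"
      using less by real_asymp
    then have "eventually (\<lambda>k. q x k * (y - x) \<le> \<phi> y - \<phi> x) sequentially"
      by eventually_elim (use right[of _ "y - x" x] in simp)
    ultimately have "p x * (y - x) \<le> \<phi> y - \<phi> x"
      by (intro tendsto_upperbound) auto
    then show ?thesis by simp
  next
    case greater
    have "(\<lambda>k. q x k * (x - y)) \<longlonglongrightarrow> p x * (x - y)" by (intro tendsto_intros p)
    moreover have "eventually (\<lambda>k. \<phi> x - \<phi> y \<le> q x k * (x - y)) sequentially"
      using left[of "x - y" x] greater by simp
    ultimately have "\<phi> x - \<phi> y \<le> p x * (x - y)"
      by (intro tendsto_lowerbound) auto
    then show ?thesis by (simp add: algebra_simps)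
  qed simp
  with p show thesis unfolding q_def by (rule that[of p, rotated])
qed

section \<open>Cadlag functions on a compact interval\<close>

lemma cadlag_on_subset:
  assumes "cadlag_on S f" "S' \<subseteq> S"
  shows "cadlag_on S' f"
  unfolding cadlag_on_def
proof (intro ballI conjI)
  fix t assume t: "t \<in> S'"
  show "(f \<longlongrightarrow> f t) (at t within S' \<inter> {t<..})"
    by (rule tendsto_within_subset[where S = "S \<inter> {t<..}"]) (use assms t in \<open>auto simp: cadlag_on_def\<close>)
  obtain l where l: "(f \<longlongrightarrow> l) (at t within S \<inter> {..<t})"
    using assms t unfolding cadlag_on_def by blast
  have "(f \<longlongrightarrow> l) (at t within S' \<inter> {..<t})"
    by (rule tendsto_within_subset[OF l]) (use assms(2) in blast)
  then show "\<exists>l. (f \<longlongrightarrow> l) (at t within S' \<inter> {..<t})" ..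
qed

text \<open>The one-sided limits control \<open>f\<close> on both sides of each point, and bisection
  turns these local bounds into a global one.\<close>

lemma cadlag_on_bounded:
  assumes f: "cadlag_on {0..T} f"
  shows "bounded (f ` {0..T})"
proof (cases "0 \<le> T")
  case True
  have "bounded (f ` ({0..T} \<inter> {0..T}))"
  \<comment> \<open>The intersection with \<open>{0..T}\<close> is needed because the small
    intervals around an end point may leave \<open>{0..T}\<close>.\<close>
  proof (rule Bolzano[where P = "\<lambda>a b. bounded (f ` ({a..b} \<inter> {0..T}))"])
    show "0 \<le> T" by fact
  next
    fix a b c :: real
    assume "a \<le> b" "b \<le> c" and P: "bounded (f ` ({a..b} \<inter> {0..T}))" "bounded (f ` ({b..c} \<inter> {0..T}))"
    have "f ` ({a..c} \<inter> {0..T}) \<subseteq> f ` ({a..b} \<inter> {0..T}) \<union> f ` ({b..c} \<inter> {0..T})" unfolding image_Un[symmetric] by (intro image_mono) auto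
    then show "bounded (f ` ({a..c} \<inter> {0..T}))"
      using P bounded_Un bounded_subset by metis
  next
    fix x assume x: "0 \<le> x" "x \<le> T"
    then obtain l where l: "(f \<longlongrightarrow> l) (at x within {0..T} \<inter> {..<x})"
      and r: "(f \<longlongrightarrow> f x) (at x within {0..T} \<inter> {x<..})"
      using f unfolding cadlag_on_def by (meson atLeastAtMost_iff)
    obtain d1 where d1: "d1 > 0" "\<And>u. u \<in> {0..T} \<inter> {..<x} \<Longrightarrow> dist u x < d1 \<Longrightarrow> dist (f u) l < 1"
      using tendstoD[OF l, of 1] unfolding eventually_at by auto
    obtain d2 where d2: "d2 > 0" "\<And>u. u \<in> {0..T} \<inter> {x<..} \<Longrightarrow> dist u x < d2 \<Longrightarrow> dist (f u) (f x) < 1"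
      using tendstoD[OF r, of 1] unfolding eventually_at by auto
    show "\<exists>d>0. \<forall>a b. a \<le> x \<and> x \<le> b \<and> b - a < d \<longrightarrow> bounded (f ` ({a..b} \<inter> {0..T}))"
    proof (intro exI conjI allI impI)
      show "min d1 d2 > 0" using d1 d2 by simp
      fix a b assume ab: "a \<le> x \<and> x \<le> b \<and> b - a < min d1 d2"
      have "f ` ({a..b} \<inter> {0..T}) \<subseteq> ball l 1 \<union> ball (f x) 1"
      proof
        fix v assume "v \<in> f ` ({a..b} \<inter> {0..T})"
        then obtain u where u: "u \<in> {a..b}" "u \<in> {0..T}" "v = f u" by auto
        consider "u < x" | "u = x" | "u > x" by linarith
        then show "v \<in> ball l 1 \<union> ball (f x) 1"
          using d1(2)[of u] d2(2)[of u] u ab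
          by cases (auto simp: dist_real_def)
      qed
      then show "bounded (f ` ({a..b} \<inter> {0..T}))"
        by (meson bounded_Un bounded_ball bounded_subset)
    qed
  qed
  then show ?thesis by simp
qed simp

section \<open>From association of two centred variables to convex order\<close>

text \<open>The negative part of \<open>f + g\<close> is at most the absolute value of
  \<open>g\<close>, so its integral is finite and the difference of the two integrals is never
  undetermined.\<close>

lemma ext_expectation_add_integrable:
  assumes f[measurable]: "f \<in> borel_measurable M" and f0: "\<And>\<omega>. f \<omega> \<ge> 0"
    and g: "integrable M g"
  shows "ext_expectation M (\<lambda>\<omega>. f \<omega> + g \<omega>) = enn2ereal (\<integral>\<^sup>+\<omega>. ennreal (f \<omega>) \<partial>M) + ereal (\<integral>\<omega>. g \<omega> \<partial>M)"
proof -
  note [measurable] = borel_measurable_integrable[OF g]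
  have gfin: "(\<integral>\<^sup>+\<omega>. ennreal \<bar>g \<omega>\<bar> \<partial>M) < \<infinity>"
    using g by (simp add: integrable_iff_bounded)
  have neg: "(\<integral>\<^sup>+\<omega>. ennreal (- (f \<omega> + g \<omega>)) \<partial>M) < \<infinity>"
  proof (rule le_less_trans[OF nn_integral_mono gfin])
    show "ennreal (- (f \<omega> + g \<omega>)) \<le> ennreal \<bar>g \<omega>\<bar>" for \<omega>
      using f0[of \<omega>] by (intro ennreal_leI) linarith
  qed
  show ?thesis
  proof (cases "(\<integral>\<^sup>+\<omega>. ennreal (f \<omega>) \<partial>M) < \<infinity>")
    case True
    have fi: "integrable M f" using True f0 by (simp add: integrable_iff_bounded)
    have h: "integrable M (\<lambda>\<omega>. f \<omega> + g \<omega>)" using fi g by simp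
    have pos: "(\<integral>\<^sup>+\<omega>. ennreal (f \<omega> + g \<omega>) \<partial>M) < \<infinity>"
    proof (rule le_less_trans[OF nn_integral_mono])
      show "ennreal (f \<omega> + g \<omega>) \<le> ennreal (norm (f \<omega> + g \<omega>))" for \<omega>
        by (intro ennreal_leI) simp
      show "(\<integral>\<^sup>+\<omega>. ennreal (norm (f \<omega> + g \<omega>)) \<partial>M) < \<infinity>"
        using h unfolding integrable_iff_bounded by blast
    qed
    have fin: "enn2ereal x = ereal (enn2real x)" if "x < \<infinity>" for x
      using that by (cases x) auto
    have "ext_expectation M (\<lambda>\<omega>. f \<omega> + g \<omega>) = ereal (\<integral>\<omega>. f \<omega> + g \<omega> \<partial>M)"
      unfolding ext_expectation_def fin[OF pos] fin[OF neg] using real_lebesgue_integral_def[OF h] by simp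
    also have "\<dots> = ereal (\<integral>\<omega>. f \<omega> \<partial>M) + ereal (\<integral>\<omega>. g \<omega> \<partial>M)"
      using fi g by simp
    also have "ereal (\<integral>\<omega>. f \<omega> \<partial>M) = enn2ereal (\<integral>\<^sup>+\<omega>. ennreal (f \<omega>) \<partial>M)"
      using nn_integral_eq_integral[OF fi] f0 by simp
    finally show ?thesis .
  next
    case False
    then have inf: "(\<integral>\<^sup>+\<omega>. ennreal (f \<omega>) \<partial>M) = \<infinity>"
      unfolding infinity_ennreal_def less_top[symmetric] by simp
    \<comment> \<open>A finite positive part of \<open>f + g\<close> would make the integral of
      \<open>f\<close> finite.\<close>
    have "(\<integral>\<^sup>+\<omega>. ennreal (f \<omega>) \<partial>M) \<le> (\<integral>\<^sup>+\<omega>. ennreal (f \<omega> + g \<omega>) + ennreal \<bar>g \<omega>\<bar> \<partial>M)"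
    proof (rule nn_integral_mono)
      fix \<omega>
      have "ennreal (f \<omega>) \<le> ennreal (max 0 (f \<omega> + g \<omega>) + \<bar>g \<omega>\<bar>)"
        by (intro ennreal_leI) linarith
      also have "\<dots> = ennreal (f \<omega> + g \<omega>) + ennreal \<bar>g \<omega>\<bar>"
        by (subst ennreal_plus) auto
      finally show "ennreal (f \<omega>) \<le> ennreal (f \<omega> + g \<omega>) + ennreal \<bar>g \<omega>\<bar>" .
    qed
    also have "\<dots> = (\<integral>\<^sup>+\<omega>. ennreal (f \<omega> + g \<omega>) \<partial>M) + (\<integral>\<^sup>+\<omega>. ennreal \<bar>g \<omega>\<bar> \<partial>M)"
      by (rule nn_integral_add) auto
    finally have "(\<integral>\<^sup>+\<omega>. ennreal (f \<omega> + g \<omega>) \<partial>M) = \<infinity>"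
      using gfin inf by (auto simp: top_unique ennreal_add_eq_top)
    moreover obtain r where "(\<integral>\<^sup>+\<omega>. ennreal (- (f \<omega> + g \<omega>)) \<partial>M) = ennreal r" "r \<ge> 0"
      using neg by (metis less_top ennreal_cases infinity_ennreal_def)
    ultimately show ?thesis
      unfolding ext_expectation_def inf by simp
  qed
qed

text \<open>Clamping \<open>W\<close> to \<open>[-k,k]\<close> gives an admissible test function.
  Dominated convergence, with \<open>g\<close> bounded and \<open>W\<close> integrable, passes to
  the limit, where the product of expectations vanishes because \<open>W\<close> is centred.\<close>

lemma (in prob_space) association_integral_mult_nonneg:
  assumes W: "integrable M W" "expectation W = 0"
    and U[measurable]: "U \<in> borel_measurable M"
    and assoc: "\<And>g h :: real \<Rightarrow> real. continuous_on UNIV g \<Longrightarrow> mono g \<Longrightarrow> bounded (range g) \<Longrightarrow>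
      continuous_on UNIV h \<Longrightarrow> mono h \<Longrightarrow> bounded (range h) \<Longrightarrow>
      expectation (\<lambda>\<omega>. g (U \<omega>)) * expectation (\<lambda>\<omega>. h (W \<omega>)) \<le> expectation (\<lambda>\<omega>. g (U \<omega>) * h (W \<omega>))"
    and g: "continuous_on UNIV g" "mono g" "bounded (range g)"
  shows "0 \<le> expectation (\<lambda>\<omega>. g (U \<omega>) * W \<omega>)"
proof -
  note [measurable] = borel_measurable_integrable[OF W(1)] borel_measurable_continuous_onI[OF g(1)]
  define h where "h k w = max (- real k) (min (real k) w)" for k w
  have hc: "continuous_on UNIV (h k)" for k unfolding h_def by (intro continuous_intros)
  have hm: "mono (h k)" for k unfolding h_def by (intro monoI) auto
  have hb: "bounded (range (h k))" for k
    unfolding h_def by (intro boundedI[where B = "real k"]) auto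
  note [measurable] = borel_measurable_continuous_onI[OF hc]
  have hle: "\<bar>h k w\<bar> \<le> \<bar>w\<bar>" for k w by (auto simp: h_def)
  have hlim: "(\<lambda>k. h k w) \<longlonglongrightarrow> w" for w
  proof (rule tendsto_eventually)
    obtain N where N: "\<bar>w\<bar> \<le> real N" using real_arch_simple by blast
    show "eventually (\<lambda>k. h k w = w) sequentially"
      by (rule eventually_sequentiallyI[of N]) (use N in \<open>auto simp: h_def\<close>)
  qed
  obtain B where B: "\<And>x. \<bar>g x\<bar> \<le> B" using g(3) by (auto simp: bounded_iff)
  have "(\<lambda>k. expectation (\<lambda>\<omega>. g (U \<omega>) * h k (W \<omega>))) \<longlonglongrightarrow> expectation (\<lambda>\<omega>. g (U \<omega>) * W \<omega>)"
  proof (rule integral_dominated_convergence[where w = "\<lambda>\<omega>. B * \<bar>W \<omega>\<bar>"])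
    show "integrable M (\<lambda>\<omega>. B * \<bar>W \<omega>\<bar>)" using W by simp
    show "AE \<omega> in M. norm (g (U \<omega>) * h k (W \<omega>)) \<le> B * \<bar>W \<omega>\<bar>" for k
      using B hle order_trans[OF abs_ge_zero B] by (intro AE_I2) (auto simp: abs_mult intro!: mult_mono)
  qed (auto intro!: AE_I2 tendsto_intros hlim)
  moreover have "(\<lambda>k. expectation (\<lambda>\<omega>. h k (W \<omega>))) \<longlonglongrightarrow> expectation W"
    by (rule integral_dominated_convergence[where w = "\<lambda>\<omega>. \<bar>W \<omega>\<bar>"])
      (use W hle in \<open>auto intro!: AE_I2 hlim\<close>)
  then have "(\<lambda>k. expectation (\<lambda>\<omega>. g (U \<omega>)) * expectation (\<lambda>\<omega>. h k (W \<omega>))) \<longlonglongrightarrow> expectation (\<lambda>\<omega>. g (U \<omega>)) * expectation W"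
    by (intro tendsto_intros)
  ultimately have "expectation (\<lambda>\<omega>. g (U \<omega>)) * expectation W \<le> expectation (\<lambda>\<omega>. g (U \<omega>) * W \<omega>)"
    using assoc[OF g hc hm hb] by (intro LIMSEQ_le) auto
  then show ?thesis using W by simp
qed

text \<open>The subgradient \<open>p\<close> need be neither bounded nor continuous, so two
  approximations are nested: clamping the argument to \<open>[-n,n]\<close> gives boundedness, and
  difference quotients of index \<open>k\<close> give continuity. First \<open>k\<close> tends to
  infinity by dominated convergence, then \<open>n\<close> by Fatou.\<close>

lemma (in prob_space) association_convex_order:
  assumes U: "integrable M U" "expectation U = 0" and W: "integrable M W" "expectation W = 0"
    and assoc: "\<And>g h :: real \<Rightarrow> real. continuous_on UNIV g \<Longrightarrow> mono g \<Longrightarrow> bounded (range g) \<Longrightarrow>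
      continuous_on UNIV h \<Longrightarrow> mono h \<Longrightarrow> bounded (range h) \<Longrightarrow>
      expectation (\<lambda>\<omega>. g (U \<omega>)) * expectation (\<lambda>\<omega>. h (W \<omega>)) \<le> expectation (\<lambda>\<omega>. g (U \<omega>) * h (W \<omega>))"
    and \<phi>: "convex_on UNIV \<phi>"
  shows "ext_expectation M (\<lambda>\<omega>. \<phi> (U \<omega>)) \<le> ext_expectation M (\<lambda>\<omega>. \<phi> (U \<omega> + W \<omega>))"
proof -
  obtain p where sub: "\<And>x y. \<phi> y \<ge> \<phi> x + p x * (y - x)"
    and lim: "\<And>x. (\<lambda>k. real (Suc k) * (\<phi> (x + 1 / real (Suc k)) - \<phi> x)) \<longlonglongrightarrow> p x"
    using convex_on_right_derivative[OF \<phi>] by blast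
  have contphi: "continuous_on UNIV \<phi>" using \<phi> by (intro convex_on_continuous) auto
  have pmono: "p x \<le> p y" if "x \<le> y" for x y
  proof (cases "x = y")
    case False
    have "p x * (y - x) \<le> p y * (y - x)"
      using sub[of x y] sub[of y x] by (simp add: algebra_simps)
    then show ?thesis using False that by simp
  qed simp
  define q where "q k x = real (Suc k) * (\<phi> (x + 1 / real (Suc k)) - \<phi> x)" for k x
  define c where "c n x = max (- real n) (min (real n) x)" for n x
  have cn: "- real n \<le> c n x" "c n x \<le> real n" for n x by (auto simp: c_def)
  have ccont: "continuous_on UNIV (c n)" for n unfolding c_def by (intro continuous_intros)
  have qcont: "continuous_on UNIV (\<lambda>x. q k (c n x))" for k n
    unfolding q_def by (intro continuous_intros continuous_on_compose2[OF contphi] ccont) auto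
  have qmono: "mono (\<lambda>x. q k (c n x))" for k n
    unfolding q_def
    by (intro monoI mult_left_mono convex_on_increment_mono[OF \<phi>]) (auto simp: c_def)
  \<comment> \<open>The quotient lies between the subgradients at the two ends of its chord. Chords
    have length at most 1, so the bound in \<open>qbound\<close> is uniform in \<open>k\<close>;
    this is the origin of \<open>real n + 1\<close>.\<close>
  have q1: "p x \<le> q k x" for x k
    using sub[of x "x + 1 / real (Suc k)"] by (simp add: q_def field_simps)
  have q2: "q k x \<le> p (x + 1)" for x k
  proof -
    have "q k x \<le> p (x + 1 / real (Suc k))"
      using sub[of "x + 1 / real (Suc k)" x] by (simp add: q_def field_simps)
    also have "\<dots> \<le> p (x + 1)" by (intro pmono) (simp add: field_simps)
    finally show ?thesis .
  qed
  have qbound: "\<bar>q k (c n x)\<bar> \<le> max \<bar>p (- real n)\<bar> \<bar>p (real n + 1)\<bar>" for k n x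
    using q1[of "c n x" k] q2[of k "c n x"] pmono[OF cn(1)[of n x]] pmono[of "c n x + 1" "real n + 1"] cn[of n x]
    by linarith
  have pbound: "\<bar>p (c n x)\<bar> \<le> max \<bar>p (- real n)\<bar> \<bar>p (real n + 1)\<bar>" for n x
    using pmono[OF cn(1)[of n x]] pmono[of "c n x" "real n + 1"] cn[of n x] by linarith
  have qlim: "(\<lambda>k. q k x) \<longlonglongrightarrow> p x" for x using lim by (simp only: q_def)
  note [measurable] = borel_measurable_integrable[OF U(1)] borel_measurable_integrable[OF W(1)]
    borel_measurable_continuous_onI[OF contphi] borel_measurable_continuous_onI[OF ccont]
  have [measurable]: "(\<lambda>x. q k x) \<in> borel_measurable borel" for k unfolding q_def by measurable
  have [measurable]: "p \<in> borel_measurable borel"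
    by (rule borel_measurable_LIMSEQ_real[OF qlim]) measurable
  have pW: "integrable M (\<lambda>\<omega>. p (c n (U \<omega>)) * W \<omega>)" for n
  proof (rule Bochner_Integration.integrable_bound)
    show "integrable M (\<lambda>\<omega>. max \<bar>p (- real n)\<bar> \<bar>p (real n + 1)\<bar> * W \<omega>)" using W by simp
    show "AE \<omega> in M. norm (p (c n (U \<omega>)) * W \<omega>) \<le> norm (max \<bar>p (- real n)\<bar> \<bar>p (real n + 1)\<bar> * W \<omega>)"
      using pbound by (intro AE_I2) (auto simp only: real_norm_def abs_mult intro!: mult_right_mono, smt)
  qed measurable
  have pos: "0 \<le> expectation (\<lambda>\<omega>. p (c n (U \<omega>)) * W \<omega>)" for n
  proof (rule LIMSEQ_le_const)
    show "(\<lambda>k. expectation (\<lambda>\<omega>. q k (c n (U \<omega>)) * W \<omega>)) \<longlonglongrightarrow> expectation (\<lambda>\<omega>. p (c n (U \<omega>)) * W \<omega>)"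
    proof (rule integral_dominated_convergence[where w = "\<lambda>\<omega>. max \<bar>p (- real n)\<bar> \<bar>p (real n + 1)\<bar> * \<bar>W \<omega>\<bar>"])
      show "AE \<omega> in M. norm (q k (c n (U \<omega>)) * W \<omega>) \<le> max \<bar>p (- real n)\<bar> \<bar>p (real n + 1)\<bar> * \<bar>W \<omega>\<bar>" for k
        using qbound by (intro AE_I2) (auto simp only: real_norm_def abs_mult intro!: mult_right_mono)
    qed (use W in \<open>auto intro!: AE_I2 tendsto_intros qlim\<close>)
    have "0 \<le> expectation (\<lambda>\<omega>. q k (c n (U \<omega>)) * W \<omega>)" for k
      by (rule association_integral_mult_nonneg[OF W _ assoc qcont qmono])
        (auto intro!: boundedI qbound)
    then show "\<exists>N. \<forall>k\<ge>N. 0 \<le> expectation (\<lambda>\<omega>. q k (c n (U \<omega>)) * W \<omega>)" by blast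
  qed
  \<comment> \<open>Subtracting a tangent makes the convex function non-negative, so that Fatou's lemma applies and
    an infinite expectation needs no separate treatment of the negative part.\<close>
  define \<psi> where "\<psi> x = \<phi> x - \<phi> 0 - p 0 * x" for x
  \<comment> \<open>Equal to \<open>\<psi>\<close> on \<open>[-n,n]\<close> and continued outside by
    the support lines at the end points with slopes from \<open>p\<close>.\<close>
  define \<psi>n where "\<psi>n n x = \<psi> (c n x) + (p (c n x) - p 0) * (x - c n x)" for n x
  have [measurable]: "\<psi> \<in> borel_measurable borel" unfolding \<psi>_def by measurable
  have [measurable]: "\<psi>n n \<in> borel_measurable borel" for n unfolding \<psi>n_def by measurable
  have \<psi>0: "\<psi> x \<ge> 0" for x using sub[of 0 x] by (simp add: \<psi>_def)
  have \<psi>n0: "\<psi>n n x \<ge> 0" for n x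
  proof -
    \<comment> \<open>To the right of \<open>n\<close> both factors are non-negative, to the left of
      \<open>-n\<close> both are non-positive, by monotonicity of \<open>p\<close>.\<close>
    have "(p (c n x) - p 0) * (x - c n x) \<ge> 0"
    proof -
      consider "\<bar>x\<bar> \<le> real n" | "x > real n" | "x < - real n" by linarith
      then show ?thesis
      proof cases
        case 1
        then have "c n x = x" by (auto simp: c_def)
        then show ?thesis by simp
      next
        case 2
        then have "c n x = real n" by (auto simp: c_def)
        then show ?thesis using 2 pmono by simp
      next
        case 3
        then have "c n x = - real n" by (auto simp: c_def)
        then show ?thesis using 3 pmono by (auto intro: mult_nonpos_nonpos)
      qed
    qed
    then show ?thesis using \<psi>0 by (simp add: \<psi>n_def)
  qed
  \<comment> \<open>This is a single support line of \<open>\<psi>\<close>, touching at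
    \<open>c n x\<close> and evaluated at \<open>x + w\<close>.\<close>
  have tangent: "\<psi>n n x + (p (c n x) - p 0) * w \<le> \<psi> (x + w)" for n x w
    using sub[of "c n x" "x + w"] by (simp add: \<psi>n_def \<psi>_def algebra_simps)
  have \<psi>n_lim: "(\<lambda>n. \<psi>n n x) \<longlonglongrightarrow> \<psi> x" for x
  proof (rule tendsto_eventually)
    obtain N where N: "\<bar>x\<bar> \<le> real N" using real_arch_simple by blast
    show "eventually (\<lambda>n. \<psi>n n x = \<psi> x) sequentially"
    proof (rule eventually_sequentiallyI[of N])
      fix n assume "N \<le> n"
      then have "c n x = x" using N by (auto simp: c_def)
      then show "\<psi>n n x = \<psi> x" by (simp add: \<psi>n_def)
    qed
  qed
  have nn: "(\<integral>\<^sup>+\<omega>. ennreal (\<psi> (U \<omega>)) \<partial>M) \<le> (\<integral>\<^sup>+\<omega>. ennreal (\<psi> (U \<omega> + W \<omega>)) \<partial>M)"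
  proof (cases "(\<integral>\<^sup>+\<omega>. ennreal (\<psi> (U \<omega> + W \<omega>)) \<partial>M) < \<infinity>")
    case True
    have \<psi>V: "integrable M (\<lambda>\<omega>. \<psi> (U \<omega> + W \<omega>))"
      using True \<psi>0 by (simp add: integrable_iff_bounded)
    have le: "(\<integral>\<^sup>+\<omega>. ennreal (\<psi>n n (U \<omega>)) \<partial>M) \<le> (\<integral>\<^sup>+\<omega>. ennreal (\<psi> (U \<omega> + W \<omega>)) \<partial>M)" for n
    proof -
      have rhs: "integrable M (\<lambda>\<omega>. \<psi> (U \<omega> + W \<omega>) - (p (c n (U \<omega>)) * W \<omega> - p 0 * W \<omega>))"
        using \<psi>V pW W by simp
      have pt: "\<psi>n n (U \<omega>) \<le> \<psi> (U \<omega> + W \<omega>) - (p (c n (U \<omega>)) * W \<omega> - p 0 * W \<omega>)" for \<omega>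
        using tangent[of n "U \<omega>" "W \<omega>"] by (simp add: left_diff_distrib)
      \<comment> \<open>Non-negativity and \<open>pt\<close> squeeze it between 0 and an integrable
        function.\<close>
      have i: "integrable M (\<lambda>\<omega>. \<psi>n n (U \<omega>))"
      proof (rule Bochner_Integration.integrable_bound[OF rhs])
        show "AE \<omega> in M. norm (\<psi>n n (U \<omega>)) \<le> norm (\<psi> (U \<omega> + W \<omega>) - (p (c n (U \<omega>)) * W \<omega> - p 0 * W \<omega>))"
          using pt \<psi>n0 by (intro AE_I2) (smt (verit) real_norm_def)
      qed measurable
      have "expectation (\<lambda>\<omega>. \<psi>n n (U \<omega>)) \<le> expectation (\<lambda>\<omega>. \<psi> (U \<omega> + W \<omega>) - (p (c n (U \<omega>)) * W \<omega> - p 0 * W \<omega>))"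
        using i rhs pt by (rule integral_mono)
      \<comment> \<open>The term with \<open>p 0\<close> disappears because \<open>W\<close> is
        centred.\<close>
      also have "\<dots> = expectation (\<lambda>\<omega>. \<psi> (U \<omega> + W \<omega>)) - expectation (\<lambda>\<omega>. p (c n (U \<omega>)) * W \<omega>)"
        using \<psi>V pW W by simp
      also have "\<dots> \<le> expectation (\<lambda>\<omega>. \<psi> (U \<omega> + W \<omega>))" using pos by simp
      finally show ?thesis
        using i \<psi>V \<psi>0 \<psi>n0 by (simp add: nn_integral_eq_integral ennreal_leI)
    qed
    have "(\<integral>\<^sup>+\<omega>. ennreal (\<psi> (U \<omega>)) \<partial>M) = (\<integral>\<^sup>+\<omega>. liminf (\<lambda>n. ennreal (\<psi>n n (U \<omega>))) \<partial>M)"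
    proof (rule nn_integral_cong)
      show "ennreal (\<psi> (U \<omega>)) = liminf (\<lambda>n. ennreal (\<psi>n n (U \<omega>)))" for \<omega>
        by (rule lim_imp_Liminf[symmetric]) (auto intro!: tendsto_ennrealI \<psi>n_lim)
    qed
    also have "\<dots> \<le> liminf (\<lambda>n. \<integral>\<^sup>+\<omega>. ennreal (\<psi>n n (U \<omega>)) \<partial>M)"
      by (rule nn_integral_liminf) measurable
    also have "\<dots> \<le> (\<integral>\<^sup>+\<omega>. ennreal (\<psi> (U \<omega> + W \<omega>)) \<partial>M)"
      using le by (intro Liminf_le) auto
    finally show ?thesis .
  next
    case False
    then show ?thesis unfolding infinity_ennreal_def less_top[symmetric] by simp
  qed
  \<comment> \<open>For a centred variable the subtracted tangent has expectation
    \<open>\<phi> 0\<close>, the same constant for \<open>U\<close> and for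
    \<open>U + W\<close>.\<close>
  have ext: "ext_expectation M (\<lambda>\<omega>. \<phi> (V \<omega>)) = enn2ereal (\<integral>\<^sup>+\<omega>. ennreal (\<psi> (V \<omega>)) \<partial>M) + ereal (\<phi> 0)"
    if "integrable M V" "expectation V = 0" for V
  proof -
    have [measurable]: "V \<in> borel_measurable M" using that by auto
    have "ext_expectation M (\<lambda>\<omega>. \<psi> (V \<omega>) + (\<phi> 0 + p 0 * V \<omega>))
        = enn2ereal (\<integral>\<^sup>+\<omega>. ennreal (\<psi> (V \<omega>)) \<partial>M) + ereal (expectation (\<lambda>\<omega>. \<phi> 0 + p 0 * V \<omega>))"
      using that \<psi>0 by (intro ext_expectation_add_integrable) auto
    then show ?thesis using that by (simp add: \<psi>_def prob_space)
  qed
  show ?thesis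
    using U W nn by (simp add: ext add_right_mono less_eq_ennreal.rep_eq)
qed

section \<open>Joint measurability and integrability of cadlag paths\<close>

text \<open>Right continuity makes the map a limit of maps that use countably many times.
  \<open>M\<close> is arbitrary so that the lemma serves for the process, for the coordinates on the
  path space and for a single path.\<close>

lemma borel_measurable_cadlag:
  assumes T: "0 \<le> T"
    and meas: "\<And>t. t \<in> {0..T} \<Longrightarrow> X t \<in> borel_measurable M"
    and cadlag: "\<And>\<omega>. \<omega> \<in> space M \<Longrightarrow> cadlag_on {0..T} (\<lambda>t. X t \<omega>)"
    and A: "A \<subseteq> {0..T}" and \<nu>: "sets \<nu> = sets (restrict_space borel A)"
  shows "(\<lambda>(s, \<omega>). X s \<omega>) \<in> borel_measurable (\<nu> \<Otimes>\<^sub>M M)"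
proof (rule borel_measurable_LIMSEQ_real)
  have sp: "space \<nu> = A" using sets_eq_imp_space_eq[OF \<nu>] by (simp add: space_restrict_space)
  \<comment> \<open>\<open>d n s\<close> takes countably many values and tends to \<open>s\<close> from the right; capping it at \<open>T\<close>
    handles \<open>s = T\<close>. The function \<open>e n\<close> is \<open>d n\<close> as a function of the integer part, with an absolute
    value that keeps its values in \<open>[0,T]\<close> on all integers.\<close>
  define d where "d n s = min T ((real_of_int \<lfloor>real (Suc n) * s\<rfloor> + 1) / real (Suc n))" for n s
  define e where "e n i = min T ((real_of_int \<bar>i\<bar> + 1) / real (Suc n))" for n i
  have idm: "(\<lambda>s. s) \<in> borel_measurable \<nu>"
    unfolding measurable_cong_sets[OF \<nu> refl] by (intro measurable_restrict_space1) simp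
  show "(\<lambda>(s, \<omega>). X (e n \<lfloor>real (Suc n) * s\<rfloor>) \<omega>) \<in> borel_measurable (\<nu> \<Otimes>\<^sub>M M)" for n
  proof -
    have fl: "(\<lambda>z. \<lfloor>real (Suc n) * fst z\<rfloor>) \<in> measurable (\<nu> \<Otimes>\<^sub>M M) (count_space UNIV)"
      using idm by measurable
    have "e n i \<in> {0..T}" for i using T by (auto simp: e_def)
    then have "(\<lambda>z. X (e n i) (snd z)) \<in> borel_measurable (\<nu> \<Otimes>\<^sub>M M)" for i
      using meas by (intro measurable_compose[OF measurable_snd]) auto
    from measurable_compose_countable[OF this fl] show ?thesis by (simp add: case_prod_unfold)
  qed
  fix z assume z: "z \<in> space (\<nu> \<Otimes>\<^sub>M M)"
  obtain s \<omega> where [simp]: "z = (s, \<omega>)" by force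
  have s: "s \<in> {0..T}" and \<omega>: "\<omega> \<in> space M" using z A sp by (auto simp: space_pair_measure)
  have ed: "e n \<lfloor>real (Suc n) * s\<rfloor> = d n s" for n using s by (auto simp: e_def d_def)
  \<comment> \<open>The inequality must be strict, since right continuity is a limit along
    \<open>{s<..}\<close>, which excludes \<open>s\<close>.\<close>
  have gt: "s < (real_of_int \<lfloor>real (Suc n) * s\<rfloor> + 1) / real (Suc n)" for n
    using real_of_int_floor_add_one_gt[of "real (Suc n) * s"]
    by (subst pos_less_divide_eq) (simp_all only: of_nat_0_less_iff zero_less_Suc mult.commute)
  have "(\<lambda>n. X (d n s) \<omega>) \<longlonglongrightarrow> X s \<omega>"
  proof (cases "s = T")
    case True
    have "d n s = s" for n using gt[of n] True by (auto simp: d_def)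
    then show ?thesis by simp
  next
    case False
    have "(\<lambda>n. d n s) \<longlonglongrightarrow> s"
    proof (rule tendsto_sandwich)
      show "eventually (\<lambda>n. s \<le> d n s) sequentially"
        using gt s by (auto simp: d_def less_imp_le)
      show "eventually (\<lambda>n. d n s \<le> s + 1 / real (Suc n)) sequentially"
      proof (rule always_eventually, rule allI)
        fix n
        have "(real_of_int \<lfloor>real (Suc n) * s\<rfloor> + 1) / real (Suc n) \<le> (real (Suc n) * s + 1) / real (Suc n)"
          by (intro divide_right_mono add_right_mono) auto
        also have "\<dots> = s + 1 / real (Suc n)" by (simp add: add_divide_distrib)
        finally show "d n s \<le> s + 1 / real (Suc n)" by (auto simp: d_def)
      qed
      show "(\<lambda>n. s + 1 / real (Suc n)) \<longlonglongrightarrow> s" by real_asymp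
    qed simp
    moreover have "d n s \<in> {0..T} \<inter> {s<..}" "d n s \<noteq> s" for n
      using gt[of n] s False by (auto simp: d_def min_def)
    ultimately have "filterlim (\<lambda>n. d n s) (at s within {0..T} \<inter> {s<..}) sequentially"
      unfolding filterlim_at by (intro conjI always_eventually allI) auto
    then show ?thesis
      using cadlag[OF \<omega>] s by (auto simp: cadlag_on_def intro: filterlim_compose[of "\<lambda>t. X t \<omega>"])
  qed
  then show "(\<lambda>n. case z of (s, \<omega>) \<Rightarrow> X (e n \<lfloor>real (Suc n) * s\<rfloor>) \<omega>) \<longlonglongrightarrow> (case z of (s, \<omega>) \<Rightarrow> X s \<omega>)"
    by (simp only: \<open>z = (s, \<omega>)\<close> prod.case ed)
qed

lemma borel_measurable_cadlag_path:
  assumes "0 \<le> T" and x: "cadlag_on {0..T} x"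
    and A: "A \<subseteq> {0..T}" and \<nu>: "sets \<nu> = sets (restrict_space borel A)"
  shows "x \<in> borel_measurable \<nu>"
proof -
  \<comment> \<open>A single path is regarded as a process on a one-point space.\<close>
  have "(\<lambda>(s, u). x s) \<in> borel_measurable (\<nu> \<Otimes>\<^sub>M count_space (UNIV :: unit set))"
    using assms by (intro borel_measurable_cadlag[where X = "\<lambda>s _. x s"]) auto
  then have "(\<lambda>s. case (s, ()) of (s, u) \<Rightarrow> x s) \<in> borel_measurable \<nu>"
    by (rule measurable_compose[rotated]) auto
  then show ?thesis by simp
qed

lemma integrable_cadlag_path:
  assumes "0 \<le> T" and x: "cadlag_on {0..T} x" and "finite_measure \<nu>"
    and A: "A \<subseteq> {0..T}" and \<nu>: "sets \<nu> = sets (restrict_space borel A)"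
  shows "integrable \<nu> x"
proof -
  interpret finite_measure \<nu> by fact
  have sp: "space \<nu> = A" using sets_eq_imp_space_eq[OF \<nu>] by (simp add: space_restrict_space)
  obtain B where "\<And>t. t \<in> {0..T} \<Longrightarrow> norm (x t) \<le> B"
    using cadlag_on_bounded[OF x] unfolding bounded_iff by blast
  then show ?thesis
    using A sp borel_measurable_cadlag_path[OF assms(1) x A \<nu>]
    by (intro integrable_const_bound[where B = B] AE_I2) auto
qed

section \<open>Time integrals as functionals on the path space\<close>

lemma space_cadlag_space: "space (cadlag_space T) = cadlag_paths T"
  by (auto simp: cadlag_space_def space_restrict_space space_PiM cadlag_paths_def PiE_def)

text \<open>The \<open>\<sigma>\<close>-field only makes evaluations measurable; joint measurability
  of \<open>(s, x)\<close> to \<open>x s\<close> allows integrating out \<open>s\<close>.\<close>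

lemma measurable_cadlag_integral:
  assumes T: "0 \<le> T" and "finite_measure \<nu>"
    and A: "A \<subseteq> {0..T}" and \<nu>: "sets \<nu> = sets (restrict_space borel A)"
  shows "(\<lambda>x. \<integral>s. x s \<partial>\<nu>) \<in> borel_measurable (cadlag_space T)"
proof -
  interpret finite_measure \<nu> by fact
  have "(\<lambda>x. x t) \<in> borel_measurable (cadlag_space T)" if "t \<in> {0..T}" for t
    unfolding cadlag_space_def
    by (intro measurable_restrict_space1 measurable_component_singleton that)
  then have "(\<lambda>(s, x). x s) \<in> borel_measurable (\<nu> \<Otimes>\<^sub>M cadlag_space T)"
    by (intro borel_measurable_cadlag[OF T _ _ A \<nu>]) (auto simp: space_cadlag_space cadlag_paths_def)
  from measurable_pair_swap[OF this]
  have "(\<lambda>(x, s). x s) \<in> borel_measurable (cadlag_space T \<Otimes>\<^sub>M \<nu>)"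
    by (simp add: case_prod_beta)
  then show ?thesis by (rule borel_measurable_lebesgue_integral)
qed

text \<open>Integration against \<open>\<nu>\<close> is Lipschitz for the sup-norm, with the total
  mass as constant.\<close>

lemma sup_norm_continuous_at_integral:
  assumes T: "0 \<le> T" and fin: "finite_measure \<nu>"
    and A: "A \<subseteq> {0..T}" and \<nu>: "sets \<nu> = sets (restrict_space borel A)"
    and g: "continuous_on UNIV g" and x: "x \<in> cadlag_paths T"
  shows "sup_norm_continuous_at T (\<lambda>x. g ((\<integral>s. x s \<partial>\<nu>) - c)) x"
  unfolding sup_norm_continuous_at_def
proof (intro allI impI)
  fix \<epsilon> :: real assume "\<epsilon> > 0"
  interpret finite_measure \<nu> by (rule fin)
  have sp: "space \<nu> = A" using sets_eq_imp_space_eq[OF \<nu>] by (simp add: space_restrict_space)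
  define I where "I y = (\<integral>s. y s \<partial>\<nu>)" for y :: "real \<Rightarrow> real"
  define m where "m = measure \<nu> (space \<nu>)"
  have m: "m \<ge> 0" by (simp add: m_def)
  have "isCont g (I x - c)" using g by (simp add: continuous_on_eq_continuous_at)
  then obtain d where d: "d > 0" "\<And>v. \<bar>v - (I x - c)\<bar> < d \<Longrightarrow> \<bar>g v - g (I x - c)\<bar> < \<epsilon>"
    using \<open>\<epsilon> > 0\<close> unfolding continuous_at_eps_delta by (auto simp: dist_real_def)
  show "\<exists>\<delta>>0. \<forall>y\<in>cadlag_paths T. sup_norm T (\<lambda>t. y t - x t) < \<delta> \<longrightarrow>
      \<bar>g ((\<integral>s. y s \<partial>\<nu>) - c) - g ((\<integral>s. x s \<partial>\<nu>) - c)\<bar> < \<epsilon>"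
  \<comment> \<open>Using \<open>m + 1\<close> instead of \<open>m\<close> covers zero mass and
    keeps the final inequality strict.\<close>
  proof (intro exI[of _ "d / (m + 1)"] conjI ballI impI)
    show "d / (m + 1) > 0" using d m by simp
    fix y assume y: "y \<in> cadlag_paths T" and close: "sup_norm T (\<lambda>t. y t - x t) < d / (m + 1)"
    have xi: "integrable \<nu> x" and yi: "integrable \<nu> y"
      using x y integrable_cadlag_path[OF T _ fin A \<nu>] by (auto simp: cadlag_paths_def)
    obtain B where B: "\<And>t. t \<in> {0..T} \<Longrightarrow> \<bar>x t\<bar> \<le> B"
      using cadlag_on_bounded[of T x] x unfolding bounded_iff cadlag_paths_def real_norm_def by blast
    obtain C where C: "\<And>t. t \<in> {0..T} \<Longrightarrow> \<bar>y t\<bar> \<le> C"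
      using cadlag_on_bounded[of T y] y unfolding bounded_iff cadlag_paths_def real_norm_def by blast
    \<comment> \<open>The real supremum in \<open>sup_norm\<close> dominates the values only once
      they are known to be bounded.\<close>
    have bdd: "bdd_above ((\<lambda>t. \<bar>y t - x t\<bar>) ` {0..T})"
      by (intro bdd_aboveI2[where M = "C + B"]) (use B C in fastforce)
    have le: "\<bar>y t - x t\<bar> \<le> d / (m + 1)" if "t \<in> {0..T}" for t
      using cSUP_upper[OF that bdd] close by (simp add: sup_norm_def)
    have "I y - I x = (\<integral>s. y s - x s \<partial>\<nu>)" using xi yi by (simp add: I_def)
    also have "\<bar>\<dots>\<bar> \<le> (\<integral>s. \<bar>y s - x s\<bar> \<partial>\<nu>)" by (rule integral_abs_bound)
    also have "\<dots> \<le> (\<integral>s. d / (m + 1) \<partial>\<nu>)"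
      using xi yi le A sp by (intro integral_mono) auto
    also have "\<dots> = m * (d / (m + 1))" by (simp add: m_def)
    also have "\<dots> < d" using d m by (simp add: field_simps)
    finally have "\<bar>(I y - c) - (I x - c)\<bar> < d" by simp
    from d(2)[OF this] show "\<bar>g ((\<integral>s. y s \<partial>\<nu>) - c) - g ((\<integral>s. x s \<partial>\<nu>) - c)\<bar> < \<epsilon>"
      by (simp add: I_def)
  qed
qed

lemma monotone_on_cadlag_integral:
  assumes T: "0 \<le> T" and fin: "finite_measure \<nu>"
    and A: "A \<subseteq> {0..T}" and \<nu>: "sets \<nu> = sets (restrict_space borel A)"
    and g: "mono g"
  shows "monotone_on (cadlag_paths T) (path_le T) (\<le>) (\<lambda>x. g ((\<integral>s. x s \<partial>\<nu>) - c))"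
proof (rule monotone_onI)
  have sp: "space \<nu> = A" using sets_eq_imp_space_eq[OF \<nu>] by (simp add: space_restrict_space)
  fix x y assume "x \<in> cadlag_paths T" "y \<in> cadlag_paths T" and le: "path_le T x y"
  then have "integrable \<nu> x" "integrable \<nu> y"
    using integrable_cadlag_path[OF T _ fin A \<nu>] by (auto simp: cadlag_paths_def)
  then have "(\<integral>s. x s \<partial>\<nu>) \<le> (\<integral>s. y s \<partial>\<nu>)"
    using le A sp by (intro integral_mono) (auto simp: path_le_def)
  then show "g ((\<integral>s. x s \<partial>\<nu>) - c) \<le> g ((\<integral>s. y s \<partial>\<nu>) - c)"
    using g by (simp add: monoD)
qed

text \<open>Non-decreasing continuous functions of time integrals are admissible functionals. The
  constants \<open>c1\<close> and \<open>c2\<close> will carry the centring.\<close>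

lemma co_monotony_principle_integrals:
  fixes g h :: "real \<Rightarrow> real"
  assumes cmp: "co_monotony_principle M T X" and T: "0 \<le> T"
    and \<nu>1: "finite_measure \<nu>1" "A1 \<subseteq> {0..T}" "sets \<nu>1 = sets (restrict_space borel A1)"
    and \<nu>2: "finite_measure \<nu>2" "A2 \<subseteq> {0..T}" "sets \<nu>2 = sets (restrict_space borel A2)"
    and g: "continuous_on UNIV g" "mono g" "bounded (range g)"
    and h: "continuous_on UNIV h" "mono h" "bounded (range h)"
  shows "(\<integral>\<omega>. g ((\<integral>s. X s \<omega> \<partial>\<nu>1) - c1) \<partial>M) * (\<integral>\<omega>. h ((\<integral>s. X s \<omega> \<partial>\<nu>2) - c2) \<partial>M)
    \<le> (\<integral>\<omega>. g ((\<integral>s. X s \<omega> \<partial>\<nu>1) - c1) * h ((\<integral>s. X s \<omega> \<partial>\<nu>2) - c2) \<partial>M)"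
proof -
  define F where "F x = g ((\<integral>s. x s \<partial>\<nu>1) - c1)" for x
  define G where "G x = h ((\<integral>s. x s \<partial>\<nu>2) - c2)" for x
  note [measurable] = borel_measurable_continuous_onI[OF g(1)] borel_measurable_continuous_onI[OF h(1)]
    measurable_cadlag_integral[OF T \<nu>1] measurable_cadlag_integral[OF T \<nu>2]
  have sp: "space \<nu>1 = A1" "space \<nu>2 = A2"
    using sets_eq_imp_space_eq[OF \<nu>1(3)] sets_eq_imp_space_eq[OF \<nu>2(3)]
    by (simp_all add: space_restrict_space)
  \<comment> \<open>Cutting the path off outside \<open>{0..T}\<close> is harmless because
    \<open>\<nu>1\<close> lives on \<open>A1\<close>.\<close>
  have F: "F (path_on T X \<omega>) = g ((\<integral>s. X s \<omega> \<partial>\<nu>1) - c1)" for \<omega>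
    unfolding F_def using sp \<nu>1(2)
    by (intro arg_cong[where f = g] arg_cong2[where f = minus] Bochner_Integration.integral_cong)
      (auto simp: path_on_def)
  have G: "G (path_on T X \<omega>) = h ((\<integral>s. X s \<omega> \<partial>\<nu>2) - c2)" for \<omega>
    unfolding G_def using sp \<nu>2(2)
    by (intro arg_cong[where f = h] arg_cong2[where f = minus] Bochner_Integration.integral_cong)
      (auto simp: path_on_def)
  have "F \<in> borel_measurable (cadlag_space T)" "G \<in> borel_measurable (cadlag_space T)"
    unfolding F_def G_def by measurable
  moreover have "bounded (F ` cadlag_paths T)" "bounded (G ` cadlag_paths T)"
    unfolding F_def G_def by (rule bounded_subset[OF g(3)] bounded_subset[OF h(3)], blast)+
  moreover have "co_monotone T F G"
    unfolding co_monotone_def F_def G_def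
    using monotone_on_cadlag_integral[OF T \<nu>1 g(2)] monotone_on_cadlag_integral[OF T \<nu>2 h(2)] by blast
  \<comment> \<open>Continuity holds at every cadlag path, so nothing about the law is
    required.\<close>
  moreover have "AE x in path_law M T X. sup_norm_continuous_at T F x"
    "AE x in path_law M T X. sup_norm_continuous_at T G x"
    unfolding F_def G_def
    by (auto intro!: AE_I2 sup_norm_continuous_at_integral[OF T \<nu>1 g(1)]
        sup_norm_continuous_at_integral[OF T \<nu>2 h(1)] simp: path_law_def space_cadlag_space)
  ultimately have "(\<integral>\<omega>. F (path_on T X \<omega>) \<partial>M) * (\<integral>\<omega>. G (path_on T X \<omega>) \<partial>M)
      \<le> (\<integral>\<omega>. F (path_on T X \<omega>) * G (path_on T X \<omega>) \<partial>M)"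
    using cmp unfolding co_monotony_principle_def by blast
  then show ?thesis by (simp only: F G)
qed

section \<open>Fubini's theorem for the process and the peacock property\<close>

text \<open>A uniform bound on the first absolute moments and the finite mass of
  \<open>\<nu>\<close> give integrability on the product space.\<close>

lemma (in prob_space) Fubini_cadlag:
  assumes T: "0 \<le> T" and int: "\<And>t. t \<in> {0..T} \<Longrightarrow> integrable M (X t)"
    and cadlag: "\<And>\<omega>. \<omega> \<in> space M \<Longrightarrow> cadlag_on {0..T} (\<lambda>t. X t \<omega>)"
    and bdd: "bdd_above ((\<lambda>s. expectation (\<lambda>\<omega>. \<bar>X s \<omega>\<bar>)) ` {0..T})"
    and fin: "finite_measure \<nu>"
    and A: "A \<subseteq> {0..T}" and \<nu>: "sets \<nu> = sets (restrict_space borel A)"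
  shows "integrable \<nu> (\<lambda>s. expectation (X s))"
    and "integrable M (\<lambda>\<omega>. \<integral>s. X s \<omega> \<partial>\<nu>)"
    and "expectation (\<lambda>\<omega>. \<integral>s. X s \<omega> \<partial>\<nu>) = (\<integral>s. expectation (X s) \<partial>\<nu>)"
proof -
  interpret \<nu>: finite_measure \<nu> by fact
  interpret pair_sigma_finite \<nu> M ..
  have sp: "space \<nu> = A" using sets_eq_imp_space_eq[OF \<nu>] by (simp add: space_restrict_space)
  have meas: "(\<lambda>(s, \<omega>). X s \<omega>) \<in> borel_measurable (\<nu> \<Otimes>\<^sub>M M)"
    using int by (intro borel_measurable_cadlag[OF T _ cadlag A \<nu>]) auto
  obtain C where C: "\<And>s. s \<in> {0..T} \<Longrightarrow> expectation (\<lambda>\<omega>. \<bar>X s \<omega>\<bar>) \<le> C"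
    using bdd unfolding bdd_above_def by blast
  have "integrable (\<nu> \<Otimes>\<^sub>M M) (\<lambda>(s, \<omega>). X s \<omega>)"
  proof (rule Fubini_integrable[OF meas])
    have "(\<lambda>s. expectation (\<lambda>\<omega>. norm (case (s, \<omega>) of (s, \<omega>) \<Rightarrow> X s \<omega>))) \<in> borel_measurable \<nu>"
      using meas by measurable
    then show "integrable \<nu> (\<lambda>s. expectation (\<lambda>\<omega>. norm (case (s, \<omega>) of (s, \<omega>) \<Rightarrow> X s \<omega>)))"
      using C A sp by (intro \<nu>.integrable_const_bound[where B = C] AE_I2) auto
    show "AE s in \<nu>. integrable M (\<lambda>\<omega>. case (s, \<omega>) of (s, \<omega>) \<Rightarrow> X s \<omega>)"
      using int A sp by (intro AE_I2) auto
  qed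
  then show "integrable \<nu> (\<lambda>s. expectation (X s))" "integrable M (\<lambda>\<omega>. \<integral>s. X s \<omega> \<partial>\<nu>)"
    "expectation (\<lambda>\<omega>. \<integral>s. X s \<omega> \<partial>\<nu>) = (\<integral>s. expectation (X s) \<partial>\<nu>)"
    using integrable_fst integrable_snd Fubini_integral by auto
qed

theorem proposition6p1:
  fixes M :: "'a measure" and X :: "real \<Rightarrow> 'a \<Rightarrow> real" and \<mu> :: "real measure"
  assumes "prob_space M"
    and "\<And>t. t \<ge> 0 \<Longrightarrow> integrable M (X t)"
    and "\<And>\<omega>. \<omega> \<in> space M \<Longrightarrow> cadlag_on {0..} (\<lambda>t. X t \<omega>)"
    and "\<And>T. T > 0 \<Longrightarrow> co_monotony_principle M T X"
    and "borel_measure_nonneg \<mu>"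
    and "\<And>t. t > 0 \<Longrightarrow> bdd_above ((\<lambda>s. \<integral>\<omega>. \<bar>X s \<omega>\<bar> \<partial>M) ` {0..t})"
    and "cadlag_on {0..} (\<lambda>t. \<integral>\<omega>. X t \<omega> \<partial>M)"
  shows "peacock M (\<lambda>t \<omega>. LINT s:{0..t}|\<mu>. (X s \<omega> - (\<integral>\<omega>'. X s \<omega>' \<partial>M)))"
proof -
  interpret prob_space M by fact
  have cadlag: "cadlag_on {0..T} (\<lambda>t. X t \<omega>)" if "\<omega> \<in> space M" for T \<omega>
    using assms(3)[OF that] by (rule cadlag_on_subset) auto
  have sets_\<mu>: "sets \<mu> = sets (restrict_space borel {0..})"
    and finite_\<mu>: "\<And>K. compact K \<Longrightarrow> K \<subseteq> {0..} \<Longrightarrow> emeasure \<mu> K < \<infinity>"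
    using assms(5) by (auto simp: borel_measure_nonneg_def)
  have in_\<mu>: "A \<in> sets \<mu>" if "A \<in> sets borel" "A \<subseteq> {0..}" for A
    using that by (simp add: sets_\<mu> sets_restrict_space_iff)
  define m where "m s = expectation (X s)" for s
  \<comment> \<open>The integral of the mean is split off as a deterministic constant, so that
    \<open>I A\<close> is a function of a path integral; \<open>set_int\<close> identifies it with
    the integral of the difference.\<close>
  define I where "I A \<omega> = (\<integral>s. X s \<omega> \<partial>restrict_space \<mu> A) - (\<integral>s. m s \<partial>restrict_space \<mu> A)" for A \<omega>
  have fin: "finite_measure (restrict_space \<mu> A)"
    and sets_res: "sets (restrict_space \<mu> A) = sets (restrict_space borel A)"
    if "A \<in> sets borel" "A \<subseteq> {0..T}" for A T
  proof -
    have A: "A \<in> sets \<mu>" using that by (intro in_\<mu>) auto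
    have "emeasure \<mu> A \<le> emeasure \<mu> {0..T}" using that by (intro emeasure_mono in_\<mu>) auto
    also have "\<dots> < \<infinity>" by (rule finite_\<mu>) auto
    finally show "finite_measure (restrict_space \<mu> A)"
      using A sets.sets_into_space[OF A]
      by (intro finite_measureI) (auto simp: emeasure_restrict_space space_restrict_space Int_absorb2)
    have "{0..} \<inter> A = A" using that by auto
    then show "sets (restrict_space \<mu> A) = sets (restrict_space borel A)"
      using restrict_space_sets_cong[OF refl sets_\<mu>, of A] by (simp add: sets_restrict_restrict_space)
  qed
  have Fubini: "integrable (restrict_space \<mu> A) m" "integrable M (I A)" "expectation (I A) = 0"
    if A: "A \<in> sets borel" "A \<subseteq> {0..T}" and T: "T > 0" for A T
    using Fubini_cadlag[OF less_imp_le[OF T] _ cadlag assms(6)[OF T] fin[OF A] A(2) sets_res[OF A]] assms(2)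
    by (auto simp: I_def[abs_def] m_def[abs_def] prob_space)
  have set_int: "set_integrable \<mu> A (\<lambda>s. X s \<omega> - m s)" "(LINT s:A|\<mu>. X s \<omega> - m s) = I A \<omega>"
    if A: "A \<in> sets borel" "A \<subseteq> {0..T}" and T: "T > 0" and \<omega>: "\<omega> \<in> space M" for A T \<omega>
  proof -
    have A': "A \<inter> space \<mu> \<in> sets \<mu>" using A by (intro sets.Int sets.top in_\<mu>) auto
    have X: "integrable (restrict_space \<mu> A) (\<lambda>s. X s \<omega>)"
      using integrable_cadlag_path[OF less_imp_le[OF T] cadlag[OF \<omega>] fin[OF A] A(2) sets_res[OF A]] .
    show "set_integrable \<mu> A (\<lambda>s. X s \<omega> - m s)"
      unfolding set_integrable_eq[OF A'] using X Fubini(1)[OF A T] by simp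
    have "(LINT s:A|\<mu>. X s \<omega> - m s) = (\<integral>s. X s \<omega> - m s \<partial>restrict_space \<mu> A)"
      by (simp only: set_lebesgue_integral_def integral_restrict_space[OF A'])
    then show "(LINT s:A|\<mu>. X s \<omega> - m s) = I A \<omega>"
      using X Fubini(1)[OF A T] by (simp add: I_def)
  qed
  define Y where "Y t \<omega> = (LINT s:{0..t}|\<mu>. X s \<omega> - m s)" for t \<omega>
  \<comment> \<open>The horizon is \<open>t + 1\<close> because the hypotheses concern positive
    horizons and \<open>t\<close> may be 0.\<close>
  have Y_eq: "Y t \<omega> = I {0..t} \<omega>" if "0 \<le> t" "\<omega> \<in> space M" for t \<omega>
    unfolding Y_def using that by (intro set_int(2)[of "{0..t}" "t + 1"]) auto
  have "peacock M Y"
    unfolding peacock_def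
  proof (intro conjI allI impI mono_onI)
    fix t :: real assume t: "0 \<le> t"
    show "integrable M (Y t)"
      using Fubini(2)[of "{0..t}" "t + 1"] t Y_eq[OF t] by (auto cong: Bochner_Integration.integrable_cong)
  next
    fix \<phi> :: "real \<Rightarrow> real" and s t :: real
    assume \<phi>: "convex_on UNIV \<phi>" and st: "s \<in> {0..}" "t \<in> {0..}" "s \<le> t"
    \<comment> \<open>The second interval is open at \<open>s\<close>, so a possible atom of
      \<open>\<mu>\<close> at \<open>s\<close> is counted only in \<open>A\<close>.\<close>
    define A B where "A = {0..s}" and "B = {s<..t}"
    have A: "A \<in> sets borel" "A \<subseteq> {0..t + 1}" and B: "B \<in> sets borel" "B \<subseteq> {0..t + 1}"
      and T: "t + 1 > 0" using st by (auto simp: A_def B_def)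
    have split: "Y t \<omega> = I A \<omega> + I B \<omega>" if \<omega>: "\<omega> \<in> space M" for \<omega>
    proof -
      have "{0..t} = A \<union> B" "A \<inter> B = {}" using st by (auto simp: A_def B_def)
      then show ?thesis
        unfolding Y_def using set_int[OF A T \<omega>] set_int[OF B T \<omega>] by (simp add: set_integral_Un)
    qed
    \<comment> \<open>\<open>Y_eq\<close> and \<open>split\<close> hold only on
      \<open>space M\<close>, which is all that the expectation sees.\<close>
    have ext_cong: "ext_expectation M f = ext_expectation M g" if "\<And>\<omega>. \<omega> \<in> space M \<Longrightarrow> f \<omega> = g \<omega>" for f g
      unfolding ext_expectation_def using that by (simp cong: nn_integral_cong)
    have "ext_expectation M (\<lambda>\<omega>. \<phi> (I A \<omega>)) \<le> ext_expectation M (\<lambda>\<omega>. \<phi> (I A \<omega> + I B \<omega>))"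
    proof (rule association_convex_order[OF Fubini(2,3)[OF A T] Fubini(2,3)[OF B T] _ \<phi>])
      fix g h :: "real \<Rightarrow> real"
      assume g: "continuous_on UNIV g" "mono g" "bounded (range g)"
        and h: "continuous_on UNIV h" "mono h" "bounded (range h)"
      show "expectation (\<lambda>\<omega>. g (I A \<omega>)) * expectation (\<lambda>\<omega>. h (I B \<omega>))
          \<le> expectation (\<lambda>\<omega>. g (I A \<omega>) * h (I B \<omega>))"
        unfolding I_def
        by (rule co_monotony_principle_integrals[OF assms(4)[OF T] less_imp_le[OF T]
              fin[OF A] A(2) sets_res[OF A] fin[OF B] B(2) sets_res[OF B] g h])
    qed
    then show "ext_expectation M (\<lambda>\<omega>. \<phi> (Y s \<omega>)) \<le> ext_expectation M (\<lambda>\<omega>. \<phi> (Y t \<omega>))"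
      using Y_eq[of s] split st by (simp add: A_def cong: ext_cong)
  qed
  then show ?thesis by (simp add: Y_def[abs_def] m_def)
qed

end
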